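(* Let $\Omega\subset\mathbb{R}^n$ be open and star shaped with respect to $0\in\Omega$. Suppose there exists a convex function $u:\Omega\to\mathbb{R}$ (convex in the sense defined in the context) such that $$\Vert\nabla u\Vert_{L^\infty(B_\delta(x)\cap\Omega)}=\infty$$ for any $x\in\partial_1\Omega$ and any $\delta>0$, where $\partial_1\Omega$ is the subset of $\partial\Omega$ defined in the context. Then $\Omega$ is convex.
   Context: Star shaped with respect to $0$ means that $tx\in\Omega$ for all $x\in\Omega$ and all $t\in[0,1]$. For such $\Omega$ define $$\partial_2\Omega:=\{x\in\partial\Omega:\ \exists\,\epsilon>0 \text{ such that } tx\in\partial\Omega \text{ for all } t\in(1-\epsilon,1+\epsilon)\},\qquad \partial_1\Omega:=\partial\Omega\setminus\partial_2\Omega.$$ A function $u:\Omega\to\mathbb{R}$ is called convex if $u(\tau x+(1-\tau)y)\le\tau u(x)+(1-\tau)u(y)$ for all $x,y\in\Omega$ and all $\tau\in(0,1)$ such that $\tau x+(1-\tau)y\in\Omega$ (it is not required that the whole segment from $x$ to $y$ lie in $\Omega$). Such a function is locally Lipschitz continuous, hence differentiable almost everywhere; $\nabla u$ is considered only at those points where $u$ is differentiable, and $L^\infty$ norms are taken with respect to Lebesgue measure. $B_\delta(x)$ denotes the open ball of radius $\delta$ centered at $x$. The set $\Omega$ is convex if $\tau x+(1-\tau)y\in\Omega$ for all $x,y\in\Omega$ and $\tau\in(0,1)$. *)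

theory Defs
  imports "HOL-Analysis.Analysis" "HOL-Probability.Essential_Supremum"
begin

definition star_shaped_0 :: "'a::real_vector set \<Rightarrow> bool" where
  "star_shaped_0 \<Omega> \<longleftrightarrow> (\<forall>x\<in>\<Omega>. \<forall>t\<in>{0..1}. t *\<^sub>R x \<in> \<Omega>)"

definition boundary2 :: "'a::real_normed_vector set \<Rightarrow> 'a set" where
  "boundary2 \<Omega> =
     {x \<in> frontier \<Omega>. \<exists>\<epsilon>>0. \<forall>t\<in>{1 - \<epsilon><..<1 + \<epsilon>}. t *\<^sub>R x \<in> frontier \<Omega>}"

definition boundary1 :: "'a::real_normed_vector set \<Rightarrow> 'a set" where
  "boundary1 \<Omega> = frontier \<Omega> - boundary2 \<Omega>"

(* Unlike convex_on, this does not ask the domain to be convex: the inequality is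
   required at every convex combination that happens to lie in the domain. *)
definition convex_fun_on :: "'a::real_vector set \<Rightarrow> ('a \<Rightarrow> real) \<Rightarrow> bool" where
  "convex_fun_on \<Omega> u \<longleftrightarrow>
     (\<forall>x\<in>\<Omega>. \<forall>y\<in>\<Omega>. \<forall>\<tau>\<in>{0<..<1}. \<tau> *\<^sub>R x + (1 - \<tau>) *\<^sub>R y \<in> \<Omega> \<longrightarrow>
        u (\<tau> *\<^sub>R x + (1 - \<tau>) *\<^sub>R y) \<le> \<tau> * u x + (1 - \<tau>) * u y)"

(* Meaningful only at points where u is differentiable. *)
definition gradient :: "('a::real_inner \<Rightarrow> real) \<Rightarrow> 'a \<Rightarrow> 'a" where
  "gradient u x = (THE D. GDERIV u x :> D)"

definition Linf_norm :: "'a measure \<Rightarrow> ('a \<Rightarrow> 'b::real_normed_vector) \<Rightarrow> ennreal" where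
  "Linf_norm M f = Inf {C. AE x in M. ennreal (norm (f x)) \<le> C}"

(* esssup differs from this only by its convention of being top on functions
   that are not measurable. *)
lemma Linf_norm_eq_esssup:
  assumes "(\<lambda>x. ennreal (norm (f x))) \<in> borel_measurable M"
  shows "Linf_norm M f = esssup M (\<lambda>x. ennreal (norm (f x)))"
  unfolding Linf_norm_def by (rule esssup_eq_AE[OF assms, symmetric])

(* The gradient is evaluated only at the points of S where u is differentiable. *)
definition Linf_norm_gradient :: "('a::euclidean_space \<Rightarrow> real) \<Rightarrow> 'a set \<Rightarrow> ennreal" where
  "Linf_norm_gradient u S =
     Linf_norm (lebesgue_on {x \<in> S. u differentiable (at x)}) (gradient u)"

end

theory Submission
  imports Defs
begin

text \<open>
  Two observations combine.

  A convex function in the sense of \<^const>\<open>convex_fun_on\<close> still lies above its tangent plane at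
  every point \<open>p\<close> of differentiability, over the whole of the open set \<open>\<Omega>\<close> and not merely over the
  part that is visible from \<open>p\<close>, because on the segment from \<open>p\<close> to another point of \<open>\<Omega>\<close>
  only the part close to \<open>p\<close> has to lie in \<open>\<Omega>\<close> (\<open>convex_fun_on_tangent_below\<close>).  Let \<open>z\<close> lie on a segment between two points
  \<open>x\<close>, \<open>y\<close> of \<open>\<Omega>\<close>.  Evaluating the tangent plane at points \<open>p\<close> near \<open>z\<close> over small balls around \<open>x\<close>
  and \<open>y\<close>, on which \<open>u\<close> is bounded above, and averaging, gives
  \<open>\<nabla>u(p) \<bullet> (z + e - p) \<le> M - u p\<close> for all small vectors \<open>e\<close>.  Since \<open>u\<close> is bounded below on bounded
  sets, the gradient is bounded near \<open>z\<close> (\<open>gradient_bounded_near_segment\<close>).  Hence the gradient can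
  blow up only at boundary points that lie on no segment with end points in \<open>\<Omega>\<close>.

  If on the other hand the segment from \<open>x\<close> to \<open>y\<close> leaves \<open>\<Omega>\<close>, shrink it towards the
  origin by the smallest factor for which it still leaves \<open>\<Omega>\<close>.  The shrunk segment meets the
  complement of \<open>\<Omega>\<close> in a point \<open>z\<close> with \<open>t z \<in> \<Omega>\<close> for all \<open>0 \<le> t < 1\<close>, so that \<open>z\<close> belongs to
  \<^term>\<open>boundary1 \<Omega>\<close>, and the end points of that segment still lie in \<open>\<Omega>\<close> by star-shapedness
  (\<open>star_shaped_segment_hits_boundary1\<close>).  The two conclusions about \<open>z\<close> contradict each other.
\<close>

section \<open>Bounds for convex functions on non-convex domains\<close>

lemma convex_fun_onD:
  assumes "convex_fun_on \<Omega> u" "x \<in> \<Omega>" "y \<in> \<Omega>" "0 < \<tau>" "\<tau> < 1"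
    and "\<tau> *\<^sub>R x + (1 - \<tau>) *\<^sub>R y \<in> \<Omega>"
  shows "u (\<tau> *\<^sub>R x + (1 - \<tau>) *\<^sub>R y) \<le> \<tau> * u x + (1 - \<tau>) * u y"
  using assms by (auto simp: convex_fun_on_def)

lemma convex_fun_on_imp_convex_on:
  assumes u: "convex_fun_on \<Omega> u" and S: "S \<subseteq> \<Omega>" "convex S"
  shows "convex_on S u"
proof (rule convex_onI[OF _ S(2)])
  fix t :: real and x y
  assume t: "0 < t" "t < 1" and xy: "x \<in> S" "y \<in> S"
  have "t *\<^sub>R y + (1 - t) *\<^sub>R x \<in> S"
    using t xy by (intro convexD[OF S(2)]) auto
  then show "u ((1 - t) *\<^sub>R x + t *\<^sub>R y) \<le> (1 - t) * u x + t * u y"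
    using convex_fun_onD[OF u, of y x t] t xy S(1) by (auto simp: add.commute)
qed

lemma convex_fun_on_locally_bounded_above:
  fixes \<Omega> :: "'a::euclidean_space set"
  assumes u: "convex_fun_on \<Omega> u" and "open \<Omega>" "x \<in> \<Omega>"
  obtains r M where "0 < r" "cball x r \<subseteq> \<Omega>" "\<And>w. w \<in> cball x r \<Longrightarrow> u w \<le> M"
proof -
  obtain d where d: "0 < d" "ball x d \<subseteq> \<Omega>"
    using \<open>open \<Omega>\<close> \<open>x \<in> \<Omega>\<close> open_contains_ball by blast
  have sub: "cball x (d/2) \<subseteq> ball x d"
    using d(1) by auto
  have "continuous_on (ball x d) u"
    using convex_fun_on_imp_convex_on[OF u d(2)] by (intro convex_on_continuous) auto
  then have "compact (u ` cball x (d/2))"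
    using sub continuous_on_subset by (intro compact_continuous_image) auto
  then have "bdd_above (u ` cball x (d/2))"
    by (intro bounded_imp_bdd_above compact_imp_bounded)
  then obtain M where "\<And>w. w \<in> cball x (d/2) \<Longrightarrow> u w \<le> M"
    unfolding bdd_above_def by blast
  then show thesis
    using that[of "d/2" M] d sub by auto
qed

text \<open>
  The value at a point \<open>a\<close> of the domain bounds the values at distant points \<open>p\<close> from below, because \<open>a\<close>
  lies between \<open>p\<close> and a point of a small ball around \<open>a\<close>.  The segment from \<open>a\<close> to \<open>p\<close> may leave
  the domain: the convexity inequality is used at \<open>a\<close> only.
\<close>

lemma convex_fun_on_bounded_below:
  fixes \<Omega> :: "'a::euclidean_space set"
  assumes u: "convex_fun_on \<Omega> u" and "open \<Omega>" and a: "a \<in> \<Omega>" and R: "0 < R"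
  obtains m where "\<And>p. p \<in> \<Omega> \<Longrightarrow> p \<in> cball a R \<Longrightarrow> m \<le> u p"
proof -
  obtain r M where r: "0 < r" and sub: "cball a r \<subseteq> \<Omega>" and M: "\<And>w. w \<in> cball a r \<Longrightarrow> u w \<le> M"
    using convex_fun_on_locally_bounded_above[OF u \<open>open \<Omega>\<close> a] by blast
  define \<tau> where "\<tau> = r / (R + r)"
  have \<tau>: "0 < \<tau>" "\<tau> < 1" and \<tau>_R: "(1 - \<tau>) * (r / R) = \<tau>"
    using r R by (auto simp: \<tau>_def field_simps)
  have "(u a - (1 - \<tau>) * M) / \<tau> \<le> u p" if p: "p \<in> \<Omega>" "p \<in> cball a R" for p
  proof -
    define q where "q = a - (r / R) *\<^sub>R (p - a)"
    have "norm ((r / R) *\<^sub>R (p - a)) \<le> (r / R) * R"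
      using p(2) r R
      by (simp only: norm_scaleR) (intro mult_mono, auto simp: dist_norm norm_minus_commute)
    then have q: "q \<in> cball a r"
      using r R by (simp add: q_def dist_norm)
    have "\<tau> *\<^sub>R p + (1 - \<tau>) *\<^sub>R q = \<tau> *\<^sub>R p + (1 - \<tau>) *\<^sub>R a - ((1 - \<tau>) * (r / R)) *\<^sub>R (p - a)"
      by (simp add: q_def algebra_simps)
    also have "\<dots> = a"
      unfolding \<tau>_R by (simp add: algebra_simps)
    finally have eq: "\<tau> *\<^sub>R p + (1 - \<tau>) *\<^sub>R q = a" .
    have "u a \<le> \<tau> * u p + (1 - \<tau>) * u q"
      using convex_fun_onD[OF u p(1) _ \<tau>, of q] q sub a by (auto simp: eq)
    also have "\<dots> \<le> \<tau> * u p + (1 - \<tau>) * M"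
      using M[OF q] \<tau> by (intro add_left_mono mult_left_mono) auto
    finally show ?thesis
      using \<tau> by (simp add: field_simps)
  qed
  then show thesis
    using that by blast
qed

section \<open>Boundedness of the gradient near segments with end points in the domain\<close>

lemma GDERIV_gradient:
  fixes u :: "'a::euclidean_space \<Rightarrow> real"
  assumes "u differentiable (at p)"
  shows "GDERIV u p :> gradient u p"
proof -
  obtain L where L: "(u has_derivative L) (at p)"
    using assms by (auto simp: differentiable_def)
  have lin: "linear L"
    using L has_derivative_linear by blast
  define D where "D = (\<Sum>b\<in>Basis. L b *\<^sub>R b)"
  have "L h = h \<bullet> D" for h
  proof -
    have "L h = L (\<Sum>b\<in>Basis. (h \<bullet> b) *\<^sub>R b)"
      by (simp add: euclidean_representation)
    also have "\<dots> = h \<bullet> D"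
      by (simp add: linear_sum[OF lin] linear_cmul[OF lin] D_def inner_sum_right mult.commute)
    finally show ?thesis .
  qed
  then have D: "GDERIV u p :> D"
    using L unfolding gderiv_def by presburger
  moreover have "E = D" if "GDERIV u p :> E" for E
  proof -
    have "(\<lambda>h. h \<bullet> E) = (\<lambda>h. h \<bullet> D)"
      using that D has_derivative_unique unfolding gderiv_def by blast
    then have "h \<bullet> E = h \<bullet> D" for h
      by meson
    then show ?thesis
      using vector_eq_ldot by blast
  qed
  ultimately show ?thesis
    unfolding gradient_def by (rule theI)
qed

text \<open>
  Here \<open>w\<close> need not be visible from \<open>p\<close>: openness of the domain puts the points of the segment that
  are close to \<open>p\<close> into it, and there the difference quotients of \<open>u\<close> in direction \<open>w - p\<close>
  are at most \<open>u w - u p\<close>.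
\<close>

lemma convex_fun_on_tangent_below:
  fixes \<Omega> :: "'a::euclidean_space set"
  assumes u: "convex_fun_on \<Omega> u" and "open \<Omega>" and p: "p \<in> \<Omega>" and w: "w \<in> \<Omega>"
    and diff: "u differentiable (at p)"
  shows "(w - p) \<bullet> gradient u p \<le> u w - u p"
proof -
  define c where "c = (\<lambda>t::real. p + t *\<^sub>R (w - p))"
  have "((\<lambda>t. u (c t)) has_derivative (\<lambda>t. (t *\<^sub>R (w - p)) \<bullet> gradient u p)) (at 0)"
  proof (rule has_derivative_compose[where f = c])
    show "(c has_derivative (\<lambda>t. t *\<^sub>R (w - p))) (at 0)"
      unfolding c_def by (auto intro!: derivative_eq_intros)
    show "(u has_derivative (\<lambda>h. h \<bullet> gradient u p)) (at (c 0))"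
      using GDERIV_gradient[OF diff] by (simp add: gderiv_def c_def)
  qed
  then have "((\<lambda>t. u (c t)) has_field_derivative (w - p) \<bullet> gradient u p) (at 0)"
    by (simp add: has_field_derivative_def mult_commute_abs)
  then have "((\<lambda>t. (u (c t) - u (c 0)) / (t - 0)) \<longlongrightarrow> (w - p) \<bullet> gradient u p) (at_right 0)"
    unfolding has_field_derivative_iff by (rule tendsto_within_subset) auto
  moreover have "\<forall>\<^sub>F t in at_right 0. (u (c t) - u (c 0)) / (t - 0) \<le> u w - u p"
  proof -
    have "(c \<longlongrightarrow> p) (at_right 0)"
      unfolding c_def by (auto intro!: tendsto_eq_intros)
    then have "\<forall>\<^sub>F t in at_right 0. c t \<in> \<Omega>"
      using \<open>open \<Omega>\<close> p by (rule topological_tendstoD)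
    moreover have "\<forall>\<^sub>F t in at_right (0::real). t \<in> {0<..<1}"
      by (rule eventually_at_right_real) simp
    ultimately show ?thesis
    proof eventually_elim
      case (elim t)
      have c: "c t = t *\<^sub>R w + (1 - t) *\<^sub>R p"
        by (simp add: c_def algebra_simps)
      have "u (c t) \<le> t * u w + (1 - t) * u p"
        using convex_fun_onD[OF u w p, of t] elim by (simp add: c)
      then show ?case
        using elim by (simp add: c_def field_simps)
    qed
  qed
  ultimately show ?thesis
    by (intro tendsto_upperbound) auto
qed

text \<open>
  Moving both end points of the segment by the vector \<open>e\<close> of length \<open>r\<close> in the direction of the
  gradient moves \<open>z\<close> by \<open>e\<close>, which contributes \<open>r\<close> times the length of the gradient to the
  averaged tangent plane inequality; staying within distance \<open>r / 2\<close> of \<open>z\<close> loses at most half of it.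
  The bound holds at every point of differentiability, so no measurability question arises.
\<close>

lemma gradient_bounded_near_segment:
  fixes \<Omega> :: "'a::euclidean_space set"
  assumes u: "convex_fun_on \<Omega> u" and op: "open \<Omega>" and x: "x \<in> \<Omega>" and y: "y \<in> \<Omega>"
    and z: "z \<in> closed_segment x y"
  obtains \<delta> where "0 < \<delta>" "Linf_norm_gradient u (ball z \<delta> \<inter> \<Omega>) < \<infinity>"
proof -
  obtain r1 M1 where 1: "0 < r1" "cball x r1 \<subseteq> \<Omega>" "\<And>w. w \<in> cball x r1 \<Longrightarrow> u w \<le> M1"
    using convex_fun_on_locally_bounded_above[OF u op x] by blast
  obtain r2 M2 where 2: "0 < r2" "cball y r2 \<subseteq> \<Omega>" "\<And>w. w \<in> cball y r2 \<Longrightarrow> u w \<le> M2"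
    using convex_fun_on_locally_bounded_above[OF u op y] by blast
  define r where "r = min r1 r2"
  define M where "M = max M1 M2"
  have r: "0 < r"
    using 1 2 by (simp add: r_def)
  obtain m where m: "\<And>p. p \<in> \<Omega> \<Longrightarrow> p \<in> cball x (dist x z + r) \<Longrightarrow> m \<le> u p"
    using convex_fun_on_bounded_below[OF u op x, of "dist x z + r"] r
    by (metis add_nonneg_pos zero_le_dist)
  obtain l where l: "0 \<le> l" "l \<le> 1" and zl: "z = (1 - l) *\<^sub>R x + l *\<^sub>R y"
    using z by (auto simp: in_segment)
  define B where "B = 2 * (M - m) / r"
  have bound: "norm (gradient u p) \<le> B"
    if p: "p \<in> ball z (r/2)" "p \<in> \<Omega>" and diff: "u differentiable (at p)" for p
  proof -
    define D where "D = gradient u p"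
    \<comment> \<open>For a vanishing gradient \<open>e\<close> is 0, and all identities below remain true.\<close>
    define e where "e = r *\<^sub>R sgn D"
    have e: "norm e \<le> r"
      using r by (simp add: e_def norm_sgn)
    have eD: "e \<bullet> D = r * norm D"
      by (cases "D = 0")
        (simp_all add: e_def sgn_div_norm power2_norm_eq_inner[symmetric] power2_eq_square)
    have tangent: "(v + e - p) \<bullet> D \<le> M - u p" if "v + e \<in> \<Omega>" "u (v + e) \<le> M" for v
      using convex_fun_on_tangent_below[OF u op p(2) that(1) diff] that(2) by (simp add: D_def)
    have "x + e \<in> cball x r1" "y + e \<in> cball y r2"
      using e by (auto simp: r_def dist_norm)
    then have "x + e \<in> \<Omega>" "u (x + e) \<le> M" "y + e \<in> \<Omega>" "u (y + e) \<le> M"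
      using 1 2 by (auto simp: M_def le_max_iff_disj)
    then have "(x + e - p) \<bullet> D \<le> M - u p" "(y + e - p) \<bullet> D \<le> M - u p"
      by (auto intro: tangent)
    then have "(1 - l) * ((x + e - p) \<bullet> D) + l * ((y + e - p) \<bullet> D)
        \<le> (1 - l) * (M - u p) + l * (M - u p)"
      using l by (intro add_mono mult_left_mono) auto
    moreover have "(1 - l) * ((x + e - p) \<bullet> D) + l * ((y + e - p) \<bullet> D) = (z - p) \<bullet> D + e \<bullet> D"
      by (simp add: zl algebra_simps inner_simps)
    ultimately have avg: "(z - p) \<bullet> D + r * norm D \<le> M - u p"
      by (simp add: eD algebra_simps)
    have "\<bar>(z - p) \<bullet> D\<bar> \<le> norm (z - p) * norm D"
      by (rule Cauchy_Schwarz_ineq2)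
    also have "\<dots> \<le> (r/2) * norm D"
      using p(1) by (intro mult_right_mono) (auto simp: dist_norm)
    finally have "\<bar>(z - p) \<bullet> D\<bar> \<le> r * norm D / 2"
      by simp
    then have "r * norm D \<le> 2 * (M - u p)"
      using avg by argo
    also have "\<dots> \<le> 2 * (M - m)"
    proof -
      have "dist x p \<le> dist x z + r"
        using p(1) r dist_triangle[of x p z] by auto
      then show ?thesis
        using m[OF p(2)] by auto
    qed
    finally show ?thesis
      using r by (simp add: B_def D_def field_simps)
  qed
  have "Linf_norm_gradient u (ball z (r/2) \<inter> \<Omega>) \<le> ennreal B"
    unfolding Linf_norm_gradient_def Linf_norm_def
  proof (intro Inf_lower CollectI AE_I2)
    fix p
    assume "p \<in> space (lebesgue_on {p \<in> ball z (r/2) \<inter> \<Omega>. u differentiable (at p)})"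
    then show "ennreal (norm (gradient u p)) \<le> ennreal B"
      using bound by (auto intro!: ennreal_leI)
  qed
  then have "Linf_norm_gradient u (ball z (r/2) \<inter> \<Omega>) < \<infinity>"
    using le_less_trans[OF _ ennreal_less_top] by simp
  then show thesis
    using that[of "r/2"] r by simp
qed

section \<open>Segments leaving a star shaped set\<close>

lemma in_boundary1_if_ray_inside:
  assumes "open \<Omega>" "z \<notin> \<Omega>" and ray: "\<And>t. 0 \<le> t \<Longrightarrow> t < 1 \<Longrightarrow> t *\<^sub>R z \<in> \<Omega>"
  shows "z \<in> boundary1 \<Omega>"
proof -
  have "((\<lambda>t. t *\<^sub>R z) \<longlongrightarrow> z) (at_left (1::real))"
    by (auto intro!: tendsto_eq_intros)
  moreover have "\<forall>\<^sub>F t in at_left (1::real). t *\<^sub>R z \<in> closure \<Omega>"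
  proof (rule eventually_mono)
    show "\<forall>\<^sub>F t in at_left (1::real). t \<in> {0<..<1}"
      by (rule eventually_at_left_real) simp
    show "t *\<^sub>R z \<in> closure \<Omega>" if "t \<in> {0<..<1}" for t
      using ray[of t] that closure_subset by auto
  qed
  ultimately have "z \<in> closure \<Omega>"
    by (intro Lim_in_closed_set[where F = "at_left (1::real)"]) auto
  then have fr: "z \<in> frontier \<Omega>"
    using \<open>z \<notin> \<Omega>\<close> \<open>open \<Omega>\<close> by (simp add: frontier_def interior_open)
  have "z \<notin> boundary2 \<Omega>"
  proof
    assume "z \<in> boundary2 \<Omega>"
    then obtain \<epsilon> where \<epsilon>: "0 < \<epsilon>" "\<forall>t\<in>{1 - \<epsilon><..<1 + \<epsilon>}. t *\<^sub>R z \<in> frontier \<Omega>"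
      by (auto simp: boundary2_def)
    define t where "t = max 0 (1 - \<epsilon>/2)"
    have "t *\<^sub>R z \<in> frontier \<Omega>" "t *\<^sub>R z \<in> \<Omega>"
      using \<epsilon> ray[of t] by (auto simp: t_def)
    then show False
      using frontier_disjoint_eq \<open>open \<Omega>\<close> by blast
  qed
  with fr show ?thesis
    by (simp add: boundary1_def)
qed

text \<open>
  The pairs \<open>(s, k)\<close> of a scaling factor and a point of the segment with \<open>s k \<notin> \<Omega>\<close> form a nonempty
  compact set, and a pair with minimal \<open>s\<close> gives the first contact point of the growing
  segment with the complement of \<open>\<Omega>\<close>.
\<close>

lemma star_shaped_segment_hits_boundary1:
  fixes \<Omega> :: "'a::euclidean_space set"
  assumes op: "open \<Omega>" and star: "star_shaped_0 \<Omega>" and x: "x \<in> \<Omega>" and y: "y \<in> \<Omega>"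
    and leaves: "\<not> closed_segment x y \<subseteq> \<Omega>"
  obtains x' y' z where "x' \<in> \<Omega>" "y' \<in> \<Omega>" "z \<in> closed_segment x' y'" "z \<in> boundary1 \<Omega>"
proof -
  define C where "C = {c \<in> {0..1::real} \<times> closed_segment x y. fst c *\<^sub>R snd c \<in> - \<Omega>}"
  have "C = ({0..1} \<times> closed_segment x y) \<inter> (\<lambda>c. fst c *\<^sub>R snd c) -` (- \<Omega>)"
    by (auto simp: C_def)
  moreover have "closed ((\<lambda>c::real \<times> 'a. fst c *\<^sub>R snd c) -` (- \<Omega>))"
    using op by (intro closed_vimage) (auto intro!: continuous_intros)
  ultimately have "compact C"
    by (simp add: compact_Int_closed compact_Times)
  moreover have "C \<noteq> {}"
  proof -
    obtain k where "k \<in> closed_segment x y" "k \<notin> \<Omega>"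
      using leaves by blast
    then have "(1, k) \<in> C"
      by (simp add: C_def)
    then show ?thesis
      by blast
  qed
  moreover have "continuous_on C fst"
    by (intro continuous_intros)
  ultimately obtain c where c: "c \<in> C" "\<And>d. d \<in> C \<Longrightarrow> fst c \<le> fst d"
    by (meson continuous_attains_inf)
  define s k where "s = fst c" and "k = snd c"
  have s: "0 \<le> s" "s \<le> 1" and k: "k \<in> closed_segment x y" and out: "s *\<^sub>R k \<notin> \<Omega>"
    using c(1) by (auto simp: C_def s_def k_def)
  have pos: "0 < s"
    \<comment> \<open>Otherwise the contact point would be the origin, which star-shapedness puts into \<open>\<Omega>\<close>.\<close>
  proof (rule ccontr)
    assume "\<not> 0 < s"
    then have "s *\<^sub>R k = 0 *\<^sub>R x"
      using s by simp
    with out star x show False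
      by (force simp: star_shaped_0_def)
  qed
  have "t *\<^sub>R (s *\<^sub>R k) \<in> \<Omega>" if "0 \<le> t" "t < 1" for t
  proof (rule ccontr)
    assume "t *\<^sub>R (s *\<^sub>R k) \<notin> \<Omega>"
    then have "(t * s, k) \<in> C"
      using that s k by (auto simp: C_def mult_le_one)
    then have "s \<le> t * s"
      using c(2) by (force simp: s_def)
    then show False
      using that pos by simp
  qed
  then have "s *\<^sub>R k \<in> boundary1 \<Omega>"
    using in_boundary1_if_ray_inside[OF op out] by blast
  moreover have "s *\<^sub>R k \<in> closed_segment (s *\<^sub>R x) (s *\<^sub>R y)"
    using k by (auto simp: closed_segment_linear_image[OF linear_scale_self])
  moreover have "s *\<^sub>R x \<in> \<Omega>" "s *\<^sub>R y \<in> \<Omega>"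
    using star x y s by (auto simp: star_shaped_0_def)
  ultimately show thesis
    using that by blast
qed

section \<open>Convexity of the domain\<close>

theorem theorem3:
  fixes \<Omega> :: "(real ^ 'n) set"
  assumes "open \<Omega>" and "0 \<in> \<Omega>" and "star_shaped_0 \<Omega>"
    and "\<exists>u. convex_fun_on \<Omega> u \<and>
           (\<forall>x\<in>boundary1 \<Omega>. \<forall>\<delta>>0. Linf_norm_gradient u (ball x \<delta> \<inter> \<Omega>) = \<infinity>)"
  shows "convex \<Omega>"
proof -
  obtain u where u: "convex_fun_on \<Omega> u"
    and blow_up: "\<And>z \<delta>. z \<in> boundary1 \<Omega> \<Longrightarrow> 0 < \<delta> \<Longrightarrow> Linf_norm_gradient u (ball z \<delta> \<inter> \<Omega>) = \<infinity>"
    using assms(4) by blast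
  have "closed_segment x y \<subseteq> \<Omega>" if xy: "x \<in> \<Omega>" "y \<in> \<Omega>" for x y
  proof (rule ccontr)
    assume "\<not> closed_segment x y \<subseteq> \<Omega>"
    then obtain x' y' z where z: "x' \<in> \<Omega>" "y' \<in> \<Omega>" "z \<in> closed_segment x' y'" "z \<in> boundary1 \<Omega>"
      using star_shaped_segment_hits_boundary1[OF assms(1,3) xy] by blast
    obtain \<delta> where "0 < \<delta>" "Linf_norm_gradient u (ball z \<delta> \<inter> \<Omega>) < \<infinity>"
      using gradient_bounded_near_segment[OF u assms(1) z(1-3)] by blast
    then show False
      using blow_up[OF z(4)] by simp
  qed
  then show ?thesis
    by (simp add: convex_contains_segment)
qed

end
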